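(* The associated 3-Novikov system is a reduction of the first negative flow of the modified Yajima–Oikawa hierarchy. Precisely: let $u_1,v_1,w_1,q_1,Q_3$ be functions of $(y,\tau)$ satisfying the associated 3-Novikov system $$\begin{aligned}u_{1\tau}&=-2q_{1y},\\ v_{1\tau}&=-q_{1yy}-u_1q_{1y}-2(Q_3q_1)_y,\\ w_{1\tau}&=-\left[Q_3q_{1y}+q_1\left(u_1Q_3+2Q_3^2-Q_{3y}\right)\right]_y,\end{aligned}$$ $$q_{1yy}+q_1(2u_1Q_3+3Q_3^2+v_1)+q_{1y}(3Q_3+u_1)+1=0,$$ $$w_1+Q_3\left(v_1+Q_3^2-3Q_{3y}-u_{1y}\right)+Q_{3yy}+(Q_3^2-Q_{3y})u_1=0.$$ Then, with $$A=-Q_3q_{1y}-Q_3^2q_1,\qquad B=-Q_3q_1,\qquad C=-q_1,$$ one has $$\begin{pmatrix} u_1 \\ v_1 \\ w_1 \end{pmatrix}_\tau=\mathcal J_1\begin{pmatrix} A \\ B \\ C \end{pmatrix},\qquad \mathcal K_1\begin{pmatrix} A \\ B \\ C \end{pmatrix}=0 .$$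
   Context: The modified Yajima–Oikawa hierarchy (Lax operator $L=\partial_y^2+u_1\partial_y+v_1+\partial_y^{-1}w_1$) has the Hamiltonian pair (with $\partial_y$ composed with multiplication operators) $$\mathcal J_1=\begin{pmatrix}0&0&2\partial_y\\ 0&2\partial_y&\partial_y^2+u_1\partial_y\\ 2\partial_y&-\partial_y^2+\partial_yu_1&0\end{pmatrix},\qquad \mathcal K_1=\begin{pmatrix}6\partial_y&*&*\\ 4u_1\partial_y&2\partial_y^3+2u_1\partial_yu_1+\partial_yv_1+v_1\partial_y&*\\ 2\partial_y^3-2\partial_yu_1\partial_y+2v_1\partial_y&\chi_1&\chi_2\end{pmatrix},$$ $$\chi_1=2w_1\partial_y+\partial_yw_1-(\partial_y^3-\partial_yu_1\partial_y+v_1\partial_y)(\partial_y-u_1),\qquad \chi_2=\partial_yu_1w_1+u_1w_1\partial_y+w_1\partial_y^2-\partial_y^2w_1,$$ where the entries $*$ are determined by skew-adjointness, i.e. $(\mathcal K_1)_{12}=4\partial_yu_1$, $(\mathcal K_1)_{13}=2\partial_y^3+2\partial_yu_1\partial_y+2\partial_yv_1$, $(\mathcal K_1)_{23}=2\partial_yw_1+w_1\partial_y+(\partial_y+u_1)(\partial_y^3+\partial_yu_1\partial_y+\partial_yv_1)$. The first negative flow of the hierarchy is, by definition, the system $(u_1,v_1,w_1)^T_\tau=\mathcal J_1(A,B,C)^T$, $\mathcal K_1(A,B,C)^T=0$ for functions $u_1,v_1,w_1,A,B,C$ of $(y,\tau)$. *)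

theory Defs
  imports "HOL-Analysis.Analysis" "HOL-Library.Function_Algebras"
begin

text \<open>
  Functions of $(y,\tau)$ take values in an arbitrary real normed field, which covers the
  real-valued and the complex-valued case. Sums, products and numerals of such functions are
  the pointwise ones.
\<close>

type_synonym 'b fld = "real \<times> real \<Rightarrow> 'b"

definition Dy :: "'b::real_normed_field fld \<Rightarrow> 'b fld" where
  "Dy f = (\<lambda>(y, t). vector_derivative (\<lambda>s. f (s, t)) (at y))"

definition Dtau :: "'b::real_normed_field fld \<Rightarrow> 'b fld" where
  "Dtau f = (\<lambda>(y, t). vector_derivative (\<lambda>s. f (y, s)) (at t))"

text \<open>
  \<open>Ck_on k \<Omega> f\<close> (for open \<open>\<Omega>\<close>): all partial derivatives of \<open>f\<close> up to order \<open>k\<close>, mixed ones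
  included, exist on \<open>\<Omega>\<close>, and those of order \<open>k\<close> are continuous there.
\<close>

primrec Ck_on :: "nat \<Rightarrow> (real \<times> real) set \<Rightarrow> 'b::real_normed_field fld \<Rightarrow> bool" where
  "Ck_on 0 \<Omega> f \<longleftrightarrow> continuous_on \<Omega> f"
| "Ck_on (Suc k) \<Omega> f \<longleftrightarrow>
     (\<forall>(y, t)\<in>\<Omega>. (\<lambda>s. f (s, t)) differentiable (at y) \<and> (\<lambda>s. f (y, s)) differentiable (at t)) \<and>
     Ck_on k \<Omega> (Dy f) \<and> Ck_on k \<Omega> (Dtau f)"

definition smooth_on :: "(real \<times> real) set \<Rightarrow> 'b::real_normed_field fld \<Rightarrow> bool" where
  "smooth_on \<Omega> f \<longleftrightarrow> (\<forall>k. Ck_on k \<Omega> f)"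

definition eq_on :: "(real \<times> real) set \<Rightarrow> 'b fld \<Rightarrow> 'b fld \<Rightarrow> bool" where
  "eq_on \<Omega> f g \<longleftrightarrow> (\<forall>p\<in>\<Omega>. f p = g p)"

type_synonym 'b oper = "'b fld \<Rightarrow> 'b fld"

definition M :: "'b::real_normed_field fld \<Rightarrow> 'b oper" where
  "M u = (\<lambda>f. u * f)"

text \<open>
  The product of operators is composition, written \<open>\<odot>\<close>; the pointwise \<open>*\<close> is applied to operators
  only with a numeral on the left, where it is multiplication by that scalar.
\<close>

abbreviation oper_comp :: "'b oper \<Rightarrow> 'b oper \<Rightarrow> 'b oper" (infixl "\<odot>" 70) where
  "P \<odot> Q \<equiv> P \<circ> Q"

definition oper_apply :: "'b::real_normed_field oper ^ 3 ^ 3 \<Rightarrow> 'b fld ^ 3 \<Rightarrow> 'b fld ^ 3" where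
  "oper_apply T X = (\<chi> i. \<Sum>j\<in>UNIV. (T $ i $ j) (X $ j))"

definition J1 :: "'b::real_normed_field fld \<Rightarrow> 'b oper ^ 3 ^ 3" where
  "J1 u = vector
     [vector [0, 0, 2 * Dy],
      vector [0, 2 * Dy, Dy ^^ 2 + M u \<odot> Dy],
      vector [2 * Dy, - (Dy ^^ 2) + Dy \<odot> M u, 0]]"

definition chi1 :: "'b::real_normed_field fld \<Rightarrow> 'b fld \<Rightarrow> 'b fld \<Rightarrow> 'b oper" where
  "chi1 u v w = 2 * (M w \<odot> Dy) + Dy \<odot> M w
     - (Dy ^^ 3 - Dy \<odot> M u \<odot> Dy + M v \<odot> Dy) \<odot> (Dy - M u)"

definition chi2 :: "'b::real_normed_field fld \<Rightarrow> 'b fld \<Rightarrow> 'b oper" where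
  "chi2 u w = Dy \<odot> M (u * w) + M (u * w) \<odot> Dy + M w \<odot> Dy ^^ 2 - Dy ^^ 2 \<odot> M w"

definition K1 :: "'b::real_normed_field fld \<Rightarrow> 'b fld \<Rightarrow> 'b fld \<Rightarrow> 'b oper ^ 3 ^ 3" where
  "K1 u v w = vector
     [vector
       [6 * Dy,
        4 * (Dy \<odot> M u),
        2 * Dy ^^ 3 + 2 * (Dy \<odot> M u \<odot> Dy) + 2 * (Dy \<odot> M v)],
      vector
       [4 * (M u \<odot> Dy),
        2 * Dy ^^ 3 + 2 * (M u \<odot> Dy \<odot> M u) + Dy \<odot> M v + M v \<odot> Dy,
        2 * (Dy \<odot> M w) + M w \<odot> Dy + (Dy + M u) \<odot> (Dy ^^ 3 + Dy \<odot> M u \<odot> Dy + Dy \<odot> M v)],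
      vector
       [2 * Dy ^^ 3 - 2 * (Dy \<odot> M u \<odot> Dy) + 2 * (M v \<odot> Dy),
        chi1 u v w,
        chi2 u w]]"

definition first_negative_flow_mYO ::
  "(real \<times> real) set \<Rightarrow> 'b::real_normed_field fld \<Rightarrow> 'b fld \<Rightarrow> 'b fld \<Rightarrow>
     'b fld \<Rightarrow> 'b fld \<Rightarrow> 'b fld \<Rightarrow> bool" where
  "first_negative_flow_mYO \<Omega> u1 v1 w1 A B C \<longleftrightarrow>
     (\<forall>i. eq_on \<Omega> (vector [Dtau u1, Dtau v1, Dtau w1] $ i) (oper_apply (J1 u1) (vector [A, B, C]) $ i)) \<and>
     (\<forall>i::3. eq_on \<Omega> (oper_apply (K1 u1 v1 w1) (vector [A, B, C]) $ i) 0)"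

definition associated_3Novikov ::
  "(real \<times> real) set \<Rightarrow> 'b::real_normed_field fld \<Rightarrow> 'b fld \<Rightarrow> 'b fld \<Rightarrow>
     'b fld \<Rightarrow> 'b fld \<Rightarrow> bool" where
  "associated_3Novikov \<Omega> u1 v1 w1 q1 Q3 \<longleftrightarrow>
     eq_on \<Omega> (Dtau u1) (- 2 * Dy q1) \<and>
     eq_on \<Omega> (Dtau v1) (- Dy (Dy q1) - u1 * Dy q1 - 2 * Dy (Q3 * q1)) \<and>
     eq_on \<Omega> (Dtau w1) (- Dy (Q3 * Dy q1 + q1 * (u1 * Q3 + 2 * Q3 ^ 2 - Dy Q3))) \<and>
     eq_on \<Omega> (Dy (Dy q1) + q1 * (2 * u1 * Q3 + 3 * Q3 ^ 2 + v1) + Dy q1 * (3 * Q3 + u1) + 1) 0 \<and>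
     eq_on \<Omega> (w1 + Q3 * (v1 + Q3 ^ 2 - 3 * Dy Q3 - Dy u1) + Dy (Dy Q3) + (Q3 ^ 2 - Dy Q3) * u1) 0"

end

theory Submission
  imports Defs
begin

text \<open>
  On an open set the iterated \<open>y\<close>-derivatives at a point obey the algebraic rules of a
  derivation, so every claim becomes a polynomial identity in the \<open>y\<close>-jets of the five functions.
  The first constraint and its \<open>y\<close>-derivatives eliminate the derivatives of \<open>q1\<close> of order at
  least 2, the second one and its \<open>y\<close>-derivatives eliminate the jets of \<open>w1\<close>; the remaining jets
  are treated as independent variables.
\<close>

section \<open>Functions with \<open>y\<close>-derivatives of all orders, and their jets\<close>

primrec ydiff :: "(real \<times> real) set \<Rightarrow> nat \<Rightarrow> 'b::real_normed_field fld \<Rightarrow> bool" where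
  "ydiff \<Omega> 0 f \<longleftrightarrow> True"
| "ydiff \<Omega> (Suc n) f \<longleftrightarrow>
     (\<forall>(y, t)\<in>\<Omega>. (\<lambda>s. f (s, t)) differentiable (at y)) \<and> ydiff \<Omega> n (Dy f)"

text \<open>Only regularity in \<open>y\<close> is recorded: \<open>J1\<close> and \<open>K1\<close>
  are built from \<open>Dy\<close> and multiplications, while the \<open>Dtau\<close> terms are
  supplied by the evolution equations.\<close>

definition ysmooth :: "(real \<times> real) set \<Rightarrow> 'b::real_normed_field fld \<Rightarrow> bool" where
  "ysmooth \<Omega> f \<longleftrightarrow> (\<forall>n. ydiff \<Omega> n f)"

definition jet :: "nat \<Rightarrow> 'b::real_normed_field fld \<Rightarrow> 'b fld" where
  "jet k f = (Dy ^^ k) f"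

lemma jet_0: "jet 0 f = f"
  and jet_Dy: "jet k (Dy f) = jet (Suc k) f"
  by (simp_all add: jet_def funpow_swap1)

text \<open>The argument \<open>p\<close> restricts rewriting to evaluated derivatives; a
  \<open>Dy\<close> below \<open>jet\<close> is absorbed by \<open>jet_Dy\<close> instead.\<close>

lemma Dy_eq_jet: "Dy f p = jet (Suc 0) f p"
  by (simp add: jet_def)

lemma ysmooth_Dy: "ysmooth \<Omega> f \<Longrightarrow> ysmooth \<Omega> (Dy f)"
  unfolding ysmooth_def by (metis ydiff.simps(2))

lemma smooth_on_imp_ysmooth:
  assumes "smooth_on \<Omega> f"
  shows "ysmooth \<Omega> f"
proof -
  have "Ck_on n \<Omega> f \<Longrightarrow> ydiff \<Omega> n f" for n
    by (induction n arbitrary: f) auto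
  with assms show ?thesis
    by (simp add: smooth_on_def ysmooth_def)
qed

lemma Dy_eqI:
  "((\<lambda>s. f (s, t)) has_vector_derivative d) (at y) \<Longrightarrow> Dy f (y, t) = d"
  by (simp add: Dy_def vector_derivative_at)

lemma has_vector_derivative_Dy:
  "(\<lambda>s. f (s, t)) differentiable (at y) \<Longrightarrow>
     ((\<lambda>s. f (s, t)) has_vector_derivative Dy f (y, t)) (at y)"
  by (simp add: Dy_def vector_derivative_works)

lemma Dy_const: "Dy (\<lambda>_. c) = 0"
  by (auto simp: fun_eq_iff intro!: Dy_eqI derivative_eq_intros)

lemma ysmooth_const: "ysmooth \<Omega> (\<lambda>_. c)"
proof -
  have "ydiff \<Omega> n (\<lambda>_. c)" for n
    by (induction n arbitrary: c) (auto simp: Dy_const zero_fun_def)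
  then show ?thesis by (simp add: ysmooth_def)
qed

text \<open>Numerals of functions are sums of the constant function \<open>1\<close>, so induction
  on the binary numeral reduces them to constants, whose derivatives vanish.\<close>

lemma numeral_fld: "(numeral n :: 'b::real_normed_field fld) = (\<lambda>_. numeral n)"
  by (induction n) (auto simp: numeral.simps fun_eq_iff)

lemma ysmooth_numeral: "ysmooth \<Omega> (numeral n)" "ysmooth \<Omega> 1"
  by (simp_all add: ysmooth_const numeral_fld one_fun_def)

lemma jet_Suc_const: "jet (Suc k) (\<lambda>_. c) p = 0"
proof -
  have "jet (Suc k) (\<lambda>_. c) = 0"
    by (induction k arbitrary: c) (simp_all add: jet_Dy[symmetric] jet_0 Dy_const zero_fun_def)
  then show ?thesis by simp
qed

lemma jet_constants:
  "jet (Suc k) (numeral n) p = 0"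
  "jet (Suc k) 1 p = 0"
  "jet k 0 p = 0"
  by (simp_all add: jet_Suc_const numeral_fld one_fun_def)
    (cases k; simp add: jet_0 jet_Suc_const zero_fun_def)

section \<open>Rules of differentiation on an open set\<close>

context
  fixes \<Omega> :: "(real \<times> real) set"
  assumes open_Omega: "open \<Omega>"
begin

lemma eventually_eq_on:
  assumes "eq_on \<Omega> f g" "(y, t) \<in> \<Omega>"
  shows "\<forall>\<^sub>F s in nhds y. f (s, t) = g (s, t)"
proof -
  have "((\<lambda>s. (s, t)) \<longlongrightarrow> (y, t)) (nhds y)"
    by (intro tendsto_intros filterlim_ident)
  then have "\<forall>\<^sub>F s in nhds y. (s, t) \<in> \<Omega>"
    using topological_tendstoD open_Omega assms(2) by blast
  then show ?thesis
    using assms(1) by (auto simp: eq_on_def elim: eventually_mono)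
qed

text \<open>Openness keeps a short segment in the \<open>y\<close>-direction inside
  \<open>\<Omega>\<close>, so both functions agree near the point. This is what permits
  differentiating the constraints.\<close>

lemma eq_on_Dy:
  assumes "eq_on \<Omega> f g"
  shows "eq_on \<Omega> (Dy f) (Dy g)"
  unfolding eq_on_def
proof
  fix p assume "p \<in> \<Omega>"
  then show "Dy f p = Dy g p"
    using eventually_eq_on[OF assms, of "fst p" "snd p"]
    by (cases p) (auto simp: Dy_def intro!: vector_derivative_cong_eq elim: eventually_mono)
qed

lemma jet_cong: "eq_on \<Omega> f g \<Longrightarrow> p \<in> \<Omega> \<Longrightarrow> jet k f p = jet k g p"
proof (induction k arbitrary: f g)
  case 0
  then show ?case by (simp add: jet_0 eq_on_def)
next
  case (Suc k)
  then show ?case by (metis eq_on_Dy jet_Dy)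
qed

lemma differentiable_cong:
  fixes f g :: "'b::real_normed_field fld"
  assumes "eq_on \<Omega> f g" "(y, t) \<in> \<Omega>" "(\<lambda>s. g (s, t)) differentiable (at y)"
  shows "(\<lambda>s. f (s, t)) differentiable (at y)"
proof -
  have "((\<lambda>s. f (s, t)) has_vector_derivative Dy g (y, t)) (at y)
          \<longleftrightarrow> ((\<lambda>s. g (s, t)) has_vector_derivative Dy g (y, t)) (at y)"
    using eventually_eq_on[OF assms(1,2)]
    by (intro has_vector_derivative_cong_ev) (auto dest: eventually_nhds_x_imp_x elim: eventually_mono)
  then show ?thesis
    using assms(3) by (metis has_vector_derivative_Dy differentiableI_vector)
qed

lemma ydiff_cong: "eq_on \<Omega> f g \<Longrightarrow> ydiff \<Omega> n g \<Longrightarrow> ydiff \<Omega> n f"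
proof (induction n arbitrary: f g)
  case (Suc n)
  then show ?case
    using eq_on_Dy[OF Suc.prems(1)] by (auto intro: differentiable_cong)
qed simp

lemma ydiff_Suc_imp: "ydiff \<Omega> (Suc n) f \<Longrightarrow> ydiff \<Omega> n f"
  by (induction n arbitrary: f) auto

text \<open>The rule is confined to \<open>\<Omega>\<close>: elsewhere differentiability is not
  assumed and \<open>vector_derivative\<close> may be an arbitrary value.\<close>

lemma Dy_add:
  assumes "ydiff \<Omega> (Suc 0) f" "ydiff \<Omega> (Suc 0) g"
  shows "eq_on \<Omega> (Dy (f + g)) (Dy f + Dy g)"
  using assms unfolding eq_on_def
  by (fastforce intro!: Dy_eqI derivative_eq_intros has_vector_derivative_Dy)

lemma Dy_mult:
  assumes "ydiff \<Omega> (Suc 0) f" "ydiff \<Omega> (Suc 0) g"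
  shows "eq_on \<Omega> (Dy (f * g)) (Dy f * g + f * Dy g)"
  using assms unfolding eq_on_def
  by (fastforce intro!: Dy_eqI derivative_eq_intros has_vector_derivative_Dy)

lemma Dy_minus:
  assumes "ydiff \<Omega> (Suc 0) f"
  shows "eq_on \<Omega> (Dy (- f)) (- Dy f)"
  using assms unfolding eq_on_def
  by (fastforce intro!: Dy_eqI derivative_eq_intros has_vector_derivative_Dy)

lemma ydiff_add: "ydiff \<Omega> n f \<Longrightarrow> ydiff \<Omega> n g \<Longrightarrow> ydiff \<Omega> n (f + g)"
proof (induction n arbitrary: f g)
  case (Suc n)
  then have "ydiff \<Omega> n (Dy (f + g))"
    by (intro ydiff_cong[OF Dy_add] Suc.IH) auto
  moreover have "\<forall>(y, t)\<in>\<Omega>. (\<lambda>s. (f + g) (s, t)) differentiable (at y)"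
    using Suc.prems by (force intro: derivative_intros)
  ultimately show ?case by (simp only: ydiff.simps)
qed simp

lemma ydiff_mult: "ydiff \<Omega> n f \<Longrightarrow> ydiff \<Omega> n g \<Longrightarrow> ydiff \<Omega> n (f * g)"
proof (induction n arbitrary: f g)
  case (Suc n)
  then have "ydiff \<Omega> n (Dy (f * g))"
    \<comment> \<open>The Leibniz rule leaves \<open>f\<close> and \<open>g\<close> undifferentiated
      as factors, so their order has to be lowered from \<open>Suc n\<close> to
      \<open>n\<close>.\<close>
    by (intro ydiff_cong[OF Dy_mult] ydiff_add Suc.IH) (auto intro: ydiff_Suc_imp)
  moreover have "\<forall>(y, t)\<in>\<Omega>. (\<lambda>s. (f * g) (s, t)) differentiable (at y)"
    using Suc.prems by (force intro: derivative_intros)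
  ultimately show ?case by (simp only: ydiff.simps)
qed simp

lemma ydiff_minus: "ydiff \<Omega> n f \<Longrightarrow> ydiff \<Omega> n (- f)"
proof (induction n arbitrary: f)
  case (Suc n)
  then have "ydiff \<Omega> n (Dy (- f))"
    by (intro ydiff_cong[OF Dy_minus] Suc.IH) auto
  moreover have "\<forall>(y, t)\<in>\<Omega>. (\<lambda>s. (- f) (s, t)) differentiable (at y)"
    using Suc.prems by (force intro: derivative_intros)
  ultimately show ?case by (simp only: ydiff.simps)
qed simp

lemma ysmooth_intros:
  "ysmooth \<Omega> f \<Longrightarrow> ysmooth \<Omega> g \<Longrightarrow> ysmooth \<Omega> (f + g)"
  "ysmooth \<Omega> f \<Longrightarrow> ysmooth \<Omega> g \<Longrightarrow> ysmooth \<Omega> (f * g)"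
  "ysmooth \<Omega> f \<Longrightarrow> ysmooth \<Omega> (- f)"
  by (simp_all add: ysmooth_def ydiff_add ydiff_mult ydiff_minus)

lemma ysmooth_diff:
  "ysmooth \<Omega> f \<Longrightarrow> ysmooth \<Omega> g \<Longrightarrow> ysmooth \<Omega> (f - g)"
  by (metis diff_conv_add_uminus ysmooth_intros(1,3))

lemma jet_add:
  "p \<in> \<Omega> \<Longrightarrow> ysmooth \<Omega> f \<Longrightarrow> ysmooth \<Omega> g \<Longrightarrow> jet k (f + g) p = jet k f p + jet k g p"
proof (induction k arbitrary: f g)
  case (Suc k)
  then have "jet (Suc k) (f + g) p = jet k (Dy f + Dy g) p"
    by (metis Dy_add jet_Dy jet_cong ysmooth_def)
  with Suc.IH Suc.prems show ?case by (metis ysmooth_Dy jet_Dy)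
qed (simp add: jet_0)

lemma jet_minus: "p \<in> \<Omega> \<Longrightarrow> ysmooth \<Omega> f \<Longrightarrow> jet k (- f) p = - jet k f p"
proof (induction k arbitrary: f)
  case (Suc k)
  then have "jet (Suc k) (- f) p = jet k (- Dy f) p"
    by (metis Dy_minus jet_Dy jet_cong ysmooth_def)
  with Suc.IH Suc.prems show ?case by (metis ysmooth_Dy jet_Dy)
qed (simp add: jet_0)

lemma jet_diff:
  "p \<in> \<Omega> \<Longrightarrow> ysmooth \<Omega> f \<Longrightarrow> ysmooth \<Omega> g \<Longrightarrow> jet k (f - g) p = jet k f p - jet k g p"
  by (metis (no_types, opaque_lifting) diff_conv_add_uminus jet_add jet_minus ysmooth_intros(3))

text \<open>One Leibniz step at a time avoids binomial sums; as a rewrite rule it terminates because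
  the order of the outer jet drops.\<close>

lemma jet_mult:
  assumes "p \<in> \<Omega>" "ysmooth \<Omega> f" "ysmooth \<Omega> g"
  shows "jet (Suc k) (f * g) p = jet k (Dy f * g) p + jet k (f * Dy g) p"
proof -
  have "jet (Suc k) (f * g) p = jet k (Dy f * g + f * Dy g) p"
    using assms by (metis Dy_mult jet_Dy jet_cong ysmooth_def)
  with assms show ?thesis
    by (simp add: jet_add ysmooth_Dy ysmooth_intros)
qed

end

theorem mainTheorem6:
  fixes \<Omega> :: "(real \<times> real) set"
    and u1 v1 w1 q1 Q3 :: "real \<times> real \<Rightarrow> 'b::real_normed_field"
  assumes "open \<Omega>"
    and "smooth_on \<Omega> u1" and "smooth_on \<Omega> v1" and "smooth_on \<Omega> w1"
    and "smooth_on \<Omega> q1" and "smooth_on \<Omega> Q3"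
    and "associated_3Novikov \<Omega> u1 v1 w1 q1 Q3"
  shows "first_negative_flow_mYO \<Omega> u1 v1 w1
           (- Q3 * Dy q1 - Q3 ^ 2 * q1) (- Q3 * q1) (- q1)"
proof -
  let ?A = "- Q3 * Dy q1 - Q3 ^ 2 * q1" and ?B = "- Q3 * q1" and ?C = "- q1"
  let ?F = "Dy (Dy q1) + q1 * (2 * u1 * Q3 + 3 * Q3 ^ 2 + v1) + Dy q1 * (3 * Q3 + u1) + 1"
  let ?G = "w1 + Q3 * (v1 + Q3 ^ 2 - 3 * Dy Q3 - Dy u1) + Dy (Dy Q3) + (Q3 ^ 2 - Dy Q3) * u1"
  note ysm = assms(2-6)[THEN smooth_on_imp_ysmooth]
  note N = assms(7)[unfolded associated_3Novikov_def]
  note ysmooth_rules = ysm ysmooth_Dy ysmooth_numeral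
    ysmooth_intros[OF assms(1)] ysmooth_diff[OF assms(1)]
  have flow: "(oper_apply (J1 u1) (vector [?A, ?B, ?C]) $ i) p = (vector [Dtau u1, Dtau v1, Dtau w1] $ i) p"
    and kernel: "(oper_apply (K1 u1 v1 w1) (vector [?A, ?B, ?C]) $ i) p = 0"
    if p: "p \<in> \<Omega>" for p and i :: 3
  proof -
    note jet_rules = Dy_eq_jet jet_0 jet_Dy jet_constants jet_minus[OF assms(1) p]
      jet_add[OF assms(1) p] jet_diff[OF assms(1) p] jet_mult[OF assms(1) p] ysmooth_rules
      power2_eq_square
    have FG: "eq_on \<Omega> ?F 0" "eq_on \<Omega> ?G 0"
      using N by blast+
    have F: "jet k ?F p = 0" and G: "jet k ?G p = 0" for k
      using FG[THEN jet_cong[OF assms(1) _ p], of k] by (simp_all only: jet_constants)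
    \<comment> \<open>Two differentiations suffice: \<open>Dy ^^ 3\<close> on \<open>A\<close> and
      fourth-order terms on \<open>B\<close> and \<open>C\<close> reach the fourth derivative of
      \<open>q1\<close>, and \<open>Dy ^^ 2 \<odot> M w\<close> in \<open>chi2\<close> reaches the
      second of \<open>w1\<close>.\<close>
    note FG_jets = F[of 0] F[of "Suc 0"] F[of "Suc (Suc 0)"]
      G[of 0] G[of "Suc 0"] G[of "Suc (Suc 0)"]
    \<comment> \<open>Right-associated, each of these reads \<open>x + rest = 0\<close> with \<open>x\<close> a jet of \<open>q1\<close> of order
      2, 3, 4 or a jet of \<open>w1\<close> of order 0, 1, 2, and is turned into \<open>x = - rest\<close>.\<close>
    note eliminate = FG_jets[simplified jet_rules add.assoc plus_fun_apply times_fun_apply minus_apply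
      one_fun_apply numeral_fld[THEN fun_cong] eq_neg_iff_add_eq_0[symmetric]]
    \<comment> \<open>After Leibniz expansion, each row of \<open>J1\<close> gives the right-hand
      side of the matching evolution equation.\<close>
    show "(oper_apply (J1 u1) (vector [?A, ?B, ?C]) $ i) p = (vector [Dtau u1, Dtau v1, Dtau w1] $ i) p"
      using exhaust_3[of i] N p
      by (elim disjE; simp add: oper_apply_def J1_def sum_3 M_def eq_on_def numeral_2_eq_2 jet_rules)
        (simp_all add: algebra_simps)
    \<comment> \<open>The first row equals \<open>- 2 * Dy ?F\<close>, the constant \<open>1\<close>
      in \<open>?F\<close> being killed by \<open>Dy\<close>. For all rows, rewriting with
      \<open>eliminate\<close> lowers the order of the jets of \<open>q1\<close> until only
      \<open>q1\<close> and its first derivative remain.\<close>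
    show "(oper_apply (K1 u1 v1 w1) (vector [?A, ?B, ?C]) $ i) p = 0"
      using exhaust_3[of i]
      by (elim disjE; simp add: oper_apply_def K1_def sum_3 M_def chi1_def chi2_def
          numeral_2_eq_2 numeral_3_eq_3 jet_rules)
        (simp_all only: eliminate, simp_all add: algebra_simps)
  qed
  show ?thesis
    unfolding first_negative_flow_mYO_def eq_on_def using flow kernel by simp
qed

end
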